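(* Let $X$ be a nontrivial complex Banach space and let $L:X\to X$ be an invertible bounded linear operator with bounded inverse. If $L$ is hyperbolic and has the topological shadowing property, then $\sigma(L)\subset\mathbb{D}$ or $\sigma(L)\subset\mathbb{C}\setminus\overline{\mathbb{D}}$.
   Context: $\mathbb{D}$ is the open unit disk in $\mathbb{C}$ and $\overline{\mathbb{D}}$ its closure. The spectrum $\sigma(L)$ is the set of $\lambda\in\mathbb{C}$ such that $L-\lambda I$ is not invertible. $L$ is hyperbolic if $\sigma(L)$ does not intersect the unit circle $\{\lambda\in\mathbb{C}:|\lambda|=1\}$. "Nontrivial" means of positive dimension. For a metric space $Y$, $C^+(Y)$ denotes the set of all continuous functions $\delta:Y\to(0,\infty)$. Let $f:Y\to Y$ be a bijective map. For $\delta\in C^+(Y)$, a sequence $(x_n)_{n\in\mathbb{Z}}$ in $Y$ is a $\delta$-pseudo orbit of $f$ if $d(f(x_n),x_{n+1})<\delta(f(x_n))$ for all $n\in\mathbb{Z}$; it can be $\delta$-shadowed if there is $x\in Y$ such that $d(f^n(x),x_n)<\delta(f^n(x))$ for all $n\in\mathbb{Z}$. The map $f$ has the topological shadowing property if for every $\epsilon\in C^+(Y)$ there exists $\delta\in C^+(Y)$ such that every $\delta$-pseudo orbit of $f$ can be $\epsilon$-shadowed. A Banach space is regarded as a metric space with the metric induced by its norm. *)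

theory Defs
  imports "HOL-Analysis.Analysis"
begin

text \<open>The underlying real structure of a complex normed space is the one inherited from
  \<^class>\<open>real_normed_vector\<close>; \<open>scaleC_of_real\<close> makes the two scalar multiplications agree.\<close>

class complex_normed_vector = real_normed_vector +
  fixes scaleC :: "complex \<Rightarrow> 'a \<Rightarrow> 'a"  (infixr "*\<^sub>C" 75)
  assumes scaleC_add_right: "a *\<^sub>C (x + y) = a *\<^sub>C x + a *\<^sub>C y"
    and scaleC_add_left: "(a + b) *\<^sub>C x = a *\<^sub>C x + b *\<^sub>C x"
    and scaleC_scaleC: "a *\<^sub>C b *\<^sub>C x = (a * b) *\<^sub>C x"
    and scaleC_of_real: "complex_of_real r *\<^sub>C x = r *\<^sub>R x"
    and norm_scaleC: "norm (a *\<^sub>C x) = cmod a * norm x"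

class complex_banach = complex_normed_vector + banach

instantiation complex :: complex_banach
begin

definition scaleC_complex_def: "(a::complex) *\<^sub>C (x::complex) = a * x"

instance
  by standard
    (simp_all add: scaleC_complex_def algebra_simps scaleR_conv_of_real norm_mult)

end

definition bounded_clinear ::
    "('a::complex_normed_vector \<Rightarrow> 'b::complex_normed_vector) \<Rightarrow> bool" where
  "bounded_clinear T \<longleftrightarrow> bounded_linear T \<and> (\<forall>c x. T (c *\<^sub>C x) = c *\<^sub>C T x)"

text \<open>Invertibility in the algebra of bounded operators: the inverse is required to be bounded.\<close>

definition invertible_op :: "('a::complex_normed_vector \<Rightarrow> 'a) \<Rightarrow> bool" where
  "invertible_op T \<longleftrightarrow> bounded_clinear T \<and>
     (\<exists>S. bounded_clinear S \<and> S \<circ> T = id \<and> T \<circ> S = id)"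

definition op_spectrum :: "('a::complex_normed_vector \<Rightarrow> 'a) \<Rightarrow> complex set" where
  "op_spectrum L = {\<mu>. \<not> invertible_op (\<lambda>x. L x - \<mu> *\<^sub>C x)}"

definition hyperbolic_op :: "('a::complex_normed_vector \<Rightarrow> 'a) \<Rightarrow> bool" where
  "hyperbolic_op L \<longleftrightarrow> op_spectrum L \<inter> {\<mu>. cmod \<mu> = 1} = {}"

definition pos_continuous :: "('a::metric_space \<Rightarrow> real) set" where
  "pos_continuous = {\<delta>. continuous_on UNIV \<delta> \<and> (\<forall>x. 0 < \<delta> x)}"

text \<open>Integer iterates; meaningful only for bijective \<open>f\<close>, and likewise for the notions below.\<close>

definition int_iterate :: "('a \<Rightarrow> 'a) \<Rightarrow> int \<Rightarrow> 'a \<Rightarrow> 'a" where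
  "int_iterate f n = (if 0 \<le> n then f ^^ nat n else inv f ^^ nat (- n))"

definition pseudo_orbit ::
    "('a::metric_space \<Rightarrow> 'a) \<Rightarrow> ('a \<Rightarrow> real) \<Rightarrow> (int \<Rightarrow> 'a) \<Rightarrow> bool" where
  "pseudo_orbit f \<delta> x \<longleftrightarrow> (\<forall>n. dist (f (x n)) (x (n + 1)) < \<delta> (f (x n)))"

definition can_be_shadowed ::
    "('a::metric_space \<Rightarrow> 'a) \<Rightarrow> ('a \<Rightarrow> real) \<Rightarrow> (int \<Rightarrow> 'a) \<Rightarrow> bool" where
  "can_be_shadowed f \<delta> x \<longleftrightarrow>
     (\<exists>y. \<forall>n. dist (int_iterate f n y) (x n) < \<delta> (int_iterate f n y))"

definition topological_shadowing :: "('a::metric_space \<Rightarrow> 'a) \<Rightarrow> bool" where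
  "topological_shadowing f \<longleftrightarrow>
     (\<forall>\<epsilon>\<in>pos_continuous. \<exists>\<delta>\<in>pos_continuous.
        \<forall>x. pseudo_orbit f \<delta> x \<longrightarrow> can_be_shadowed f \<epsilon> x)"

end

theory Submission imports Defs begin

text \<open>
  Suppose that the spectrum meets both sides of the unit circle. Then the hyperbolic operator
  \<open>L\<close> is a saddle: it has a nonzero vector \<open>a\<close> with bounded forward orbit and a nonzero vector \<open>b\<close>
  with bounded backward orbit. For small \<open>t > 0\<close>, follow the orbit of \<open>t a\<close> up to time \<open>0\<close> and the
  orbit of \<open>t b\<close> from time \<open>1\<close> on. The only jump happens near the origin, and it tends to \<open>0\<close>
  with \<open>t\<close>, so for every \<open>\<delta>\<close> this is a \<open>\<delta>\<close>-pseudo orbit once \<open>t\<close> is small. A hyperbolic operator has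
  no nonzero bounded two-sided orbit, so a point whose orbit stays at bounded distance from the
  pseudo orbit can only be \<open>t (a + b)\<close>. At time \<open>-k\<close> its orbit misses the pseudo orbit by
  \<open>t L\<^bsup>-k\<^esup> b\<close>, and this vector shrinks at most exponentially in \<open>k\<close>, because \<open>L\<close> is bounded.
  With the tolerance \<open>\<epsilon>(x) = exp (-\<parallel>x\<parallel>\<^sup>2)\<close>, shadowing therefore forces
  \<open>\<parallel>L\<^bsup>-k\<^esup> (a + b)\<parallel>\<close>, hence also \<open>\<parallel>L\<^bsup>-k\<^esup> a\<parallel>\<close>, to be \<open>O(\<surd>k)\<close>. But a two-sided orbit of so slow a
  growth vanishes as well (\<open>hyperbolic_orbit_trivial\<close>), so \<open>a = 0\<close>, a contradiction.

  The vectors \<open>a\<close> and \<open>b\<close> come from the resolvent on the unit circle, without spectral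
  projections. The Fourier coefficients \<open>g\<^sub>n\<close> of \<open>t \<mapsto> (L - e\<^bsup>it\<^esup>)\<^sup>-\<^sup>1 x\<close> are bounded uniformly in
  \<open>n\<close> and satisfy \<open>L g\<^sub>n = g\<^bsub>n+1\<^esub>\<close>, except for an extra term \<open>x\<close> at \<open>n = 0\<close>
  (\<open>hyperbolic_Green_sequence\<close>). So \<open>g\<^sub>1\<close> has a bounded forward orbit and \<open>g\<^sub>0\<close> a bounded backward
  orbit. If \<open>g\<^sub>1 = 0\<close> for every \<open>x\<close>, then the \<open>g\<^sub>n\<close> with \<open>n \<le> 0\<close> are the negative powers of \<open>L\<close>
  applied to \<open>x\<close>; these powers are then uniformly bounded, and a Neumann series keeps the spectrum
  out of the open disk. If \<open>g\<^sub>0 = 0\<close> for every \<open>x\<close>, then the nonnegative powers of \<open>L\<close> are uniformly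
  bounded and the spectrum lies in the closed disk. Otherwise \<open>a\<close> and \<open>b\<close> exist.
\<close>

section \<open>Bounded complex-linear operators\<close>

interpretation scaleC: bounded_bilinear "scaleC :: complex \<Rightarrow> 'a::complex_normed_vector \<Rightarrow> 'a"
proof
  fix a a' :: complex and b b' :: 'a and r :: real
  show "(a + a') *\<^sub>C b = a *\<^sub>C b + a' *\<^sub>C b" by (rule scaleC_add_left)
  show "a *\<^sub>C (b + b') = a *\<^sub>C b + a *\<^sub>C b'" by (rule scaleC_add_right)
  show "(r *\<^sub>R a) *\<^sub>C b = r *\<^sub>R (a *\<^sub>C b)"
    by (simp add: scaleR_conv_of_real flip: scaleC_scaleC scaleC_of_real)
  show "a *\<^sub>C (r *\<^sub>R b) = r *\<^sub>R (a *\<^sub>C b)"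
    by (simp add: scaleC_scaleC mult.commute flip: scaleC_of_real)
  show "\<exists>K. \<forall>a (b::'a). norm (a *\<^sub>C b) \<le> norm a * norm b * K"
    by (rule exI[of _ 1]) (simp add: norm_scaleC)
qed

lemma scaleC_one [simp]: "1 *\<^sub>C x = x"
  using scaleC_of_real[of 1 x] by simp

lemma bounded_clinear_scaleC: "bounded_clinear (\<lambda>x. c *\<^sub>C x)"
  by (simp add: bounded_clinear_def scaleC.bounded_linear_right scaleC_scaleC mult.commute)

lemma bounded_clinear_compose:
  "bounded_clinear S \<Longrightarrow> bounded_clinear T \<Longrightarrow> bounded_clinear (\<lambda>x. S (T x))"
  by (simp add: bounded_clinear_def bounded_linear_compose)

lemma bounded_clinear_diff:
  "bounded_clinear S \<Longrightarrow> bounded_clinear T \<Longrightarrow> bounded_clinear (\<lambda>x. S x - T x)"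
  by (simp add: bounded_clinear_def bounded_linear_sub scaleC.diff_right)

lemma bounded_clinear_ident: "bounded_clinear (\<lambda>x. x)"
  by (simp add: bounded_clinear_def bounded_linear_ident)

lemma invertible_op_iff:
  "invertible_op T \<longleftrightarrow> bounded_clinear T \<and>
     (\<exists>S. bounded_clinear S \<and> (\<forall>x. S (T x) = x) \<and> (\<forall>x. T (S x) = x))"
  by (simp add: invertible_op_def fun_eq_iff)

lemma invertible_opI:
  assumes "bounded_clinear T" "bounded_clinear S" "\<And>x. S (T x) = x" "\<And>x. T (S x) = x"
  shows "invertible_op T"
  using assms unfolding invertible_op_iff by blast

lemma invertible_op_compose:
  assumes "invertible_op S" "invertible_op T"
  shows "invertible_op (\<lambda>x. S (T x))"
proof -
  obtain S' where S:
    "bounded_clinear S" "bounded_clinear S'" "\<And>x. S' (S x) = x" "\<And>x. S (S' x) = x"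
    using assms(1) unfolding invertible_op_iff by blast
  obtain T' where T:
    "bounded_clinear T" "bounded_clinear T'" "\<And>x. T' (T x) = x" "\<And>x. T (T' x) = x"
    using assms(2) unfolding invertible_op_iff by blast
  show ?thesis
    by (rule invertible_opI[where S = "\<lambda>x. T' (S' x)"]) (simp_all add: S T bounded_clinear_compose)
qed

lemma invertible_op_scaleC:
  assumes "c \<noteq> 0"
  shows "invertible_op (\<lambda>x. c *\<^sub>C x)"
  by (rule invertible_opI[where S = "\<lambda>x. inverse c *\<^sub>C x"])
     (simp_all add: assms bounded_clinear_scaleC scaleC_scaleC)

text \<open>Power boundedness makes the Neumann series \<open>\<Sum>n. \<mu>\<^sup>n T\<^sup>n\<close> converge geometrically for every
  \<open>\<mu>\<close> in the open disk, although \<open>\<mu> T\<close> itself need not be a contraction.\<close>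

lemma invertible_op_Neumann:
  fixes T :: "'a::complex_banach \<Rightarrow> 'a"
  assumes T: "bounded_clinear T" and bound: "\<And>n x. norm ((T ^^ n) x) \<le> M * norm x"
    and \<mu>: "cmod \<mu> < 1"
  shows "invertible_op (\<lambda>x. x - \<mu> *\<^sub>C T x)"
proof -
  interpret T: bounded_linear T using T by (simp add: bounded_clinear_def)
  have T_scaleC: "T (c *\<^sub>C x) = c *\<^sub>C T x" for c x using T by (simp add: bounded_clinear_def)
  define a where "a x n = \<mu> ^ n *\<^sub>C (T ^^ n) x" for x n
  define S where "S x = (\<Sum>n. a x n)" for x
  have pow_add: "(T ^^ n) (x + y) = (T ^^ n) x + (T ^^ n) y" for n x y
    by (induction n) (simp_all add: T.add)
  have pow_scaleC: "(T ^^ n) (c *\<^sub>C x) = c *\<^sub>C (T ^^ n) x" for n x c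
    by (induction n) (simp_all add: T_scaleC)
  have a_le: "norm (a x n) \<le> cmod \<mu> ^ n * (M * norm x)" for x n
    unfolding a_def norm_scaleC norm_power by (intro mult_left_mono bound) simp
  have geo: "summable (\<lambda>n. cmod \<mu> ^ n * (M * norm x))" for x :: 'a
    using \<mu> by (intro summable_mult2 summable_geometric) simp
  have summ_norm: "summable (\<lambda>n. norm (a x n))" for x
    by (rule summable_comparison_test'[OF geo[of x], of 0]) (simp add: a_le)
  then have summ: "summable (a x)" for x by (rule summable_norm_cancel)
  have S_le: "norm (S x) \<le> norm x * (M / (1 - cmod \<mu>))" for x
  proof -
    have "norm (S x) \<le> (\<Sum>n. norm (a x n))" unfolding S_def by (rule summable_norm[OF summ_norm])
    also have "\<dots> \<le> (\<Sum>n. cmod \<mu> ^ n * (M * norm x))" by (rule suminf_le[OF a_le summ_norm geo])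
    also have "\<dots> = norm x * (M / (1 - cmod \<mu>))"
      using \<mu> by (simp add: suminf_mult2[symmetric] summable_geometric suminf_geometric)
    finally show ?thesis .
  qed
  have S_add: "S (x + y) = S x + S y" for x y
  proof -
    have "a (x + y) = (\<lambda>n. a x n + a y n)"
      by (simp add: a_def fun_eq_iff pow_add scaleC_add_right)
    then show ?thesis unfolding S_def using suminf_add[OF summ[of x] summ[of y]] by simp
  qed
  have S_scaleC: "S (c *\<^sub>C x) = c *\<^sub>C S x" for c x
  proof -
    have "a (c *\<^sub>C x) = (\<lambda>n. c *\<^sub>C a x n)"
      by (simp add: a_def fun_eq_iff pow_scaleC scaleC_scaleC mult.commute)
    then show ?thesis
      unfolding S_def using bounded_linear.suminf[OF scaleC.bounded_linear_right summ] by simp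
  qed
  have "bounded_linear S"
  proof (rule bounded_linear_intro[OF S_add _ S_le])
    fix r x show "S (r *\<^sub>R x) = r *\<^sub>R S x"
      using S_scaleC[of "of_real r" x] by (simp add: scaleC_of_real)
  qed
  then have S: "bounded_clinear S" by (simp add: bounded_clinear_def S_scaleC)
  have head: "(\<Sum>n. a x (Suc n)) = S x - x" for x
    unfolding S_def using suminf_split_head[OF summ[of x]] by (simp add: a_def)
  have "\<mu> *\<^sub>C T (S x) = (\<Sum>n. a x (Suc n))" for x
    unfolding S_def
    by (simp add: T.suminf[OF summ] bounded_linear.suminf[OF scaleC.bounded_linear_right]
        bounded_linear.summable[OF T.bounded_linear_axioms summ])
       (simp add: a_def T_scaleC scaleC_scaleC)
  moreover have "S (\<mu> *\<^sub>C T x) = (\<Sum>n. a x (Suc n))" for x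
  proof -
    have "a (\<mu> *\<^sub>C T x) = (\<lambda>n. a x (Suc n))"
      by (simp add: a_def fun_eq_iff pow_scaleC scaleC_scaleC funpow_swap1 mult.commute)
    then show ?thesis by (simp add: S_def)
  qed
  moreover have "S (x - y) = S x - S y" for x y
    using S_add[of "x - y" y] by simp
  ultimately show ?thesis
    by (intro invertible_opI[where S = S] S bounded_clinear_diff bounded_clinear_ident
        bounded_clinear_compose[OF bounded_clinear_scaleC T]) (simp_all add: head)
qed

section \<open>Spectrum and power boundedness\<close>

text \<open>For \<open>\<mu>\<close> outside the closed disk, \<open>L - \<mu> = - \<mu> (I - \<mu>\<^sup>-\<^sup>1 L)\<close> has a Neumann inverse.\<close>

lemma op_spectrum_subset_if_power_bounded:
  fixes L :: "'a::complex_banach \<Rightarrow> 'a"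
  assumes L: "bounded_clinear L" and bound: "\<And>n x. norm ((L ^^ n) x) \<le> M * norm x"
  shows "op_spectrum L \<subseteq> cball 0 1"
proof (rule ccontr)
  assume "\<not> ?thesis"
  then obtain \<mu> where \<mu>: "\<not> invertible_op (\<lambda>x. L x - \<mu> *\<^sub>C x)" "cmod \<mu> > 1"
    unfolding op_spectrum_def by force
  have "invertible_op (\<lambda>x. x - inverse \<mu> *\<^sub>C L x)"
    using \<mu>(2) by (intro invertible_op_Neumann[OF L bound]) (simp add: norm_inverse inverse_less_1_iff)
  moreover have "\<mu> \<noteq> 0" using \<mu>(2) by auto
  ultimately have "invertible_op (\<lambda>x. L x - \<mu> *\<^sub>C x)"
    using invertible_op_compose[OF invertible_op_scaleC, of "- \<mu>"]
    by (force simp: scaleC.diff_right scaleC.minus_left scaleC_scaleC)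
  with \<mu>(1) show False ..
qed

text \<open>For \<open>\<mu>\<close> in the open disk, \<open>L - \<mu> = (I - \<mu> L\<^sup>-\<^sup>1) L\<close> has a Neumann inverse.\<close>

lemma op_spectrum_subset_if_inverse_power_bounded:
  fixes L :: "'a::complex_banach \<Rightarrow> 'a"
  assumes inv: "bounded_clinear L" "bounded_clinear S" "\<And>x. S (L x) = x" "\<And>x. L (S x) = x"
    and bound: "\<And>n x. norm ((S ^^ n) x) \<le> M * norm x"
  shows "op_spectrum L \<subseteq> - ball 0 1"
proof (rule ccontr)
  assume "\<not> ?thesis"
  then obtain \<mu> where \<mu>: "\<not> invertible_op (\<lambda>x. L x - \<mu> *\<^sub>C x)" "cmod \<mu> < 1"
    unfolding op_spectrum_def by force
  have "invertible_op L" using inv by (rule invertible_opI)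
  from invertible_op_compose[OF invertible_op_Neumann[OF inv(2) bound \<mu>(2)] this]
  have "invertible_op (\<lambda>x. L x - \<mu> *\<^sub>C x)" by (simp add: inv)
  with \<mu>(1) show False ..
qed

section \<open>Resolvent estimates on the unit circle\<close>

text \<open>A lower bound \<open>c\<close> for \<open>L - \<nu>\<close> gives the lower bound \<open>c / 2\<close> for all \<open>L - \<mu>\<close> with
  \<open>\<bar>\<nu> - \<mu>\<bar> < c / 2\<close>, so compactness of the circle makes the bound uniform.\<close>

lemma uniformly_bounded_below_on_circle:
  fixes L :: "'a::complex_normed_vector \<Rightarrow> 'a"
  assumes "hyperbolic_op L"
  shows "\<exists>c>0. \<forall>\<mu> x. cmod \<mu> = 1 \<longrightarrow> c * norm x \<le> norm (L x - \<mu> *\<^sub>C x)"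
proof -
  have "\<exists>c>0. \<forall>x. c * norm x \<le> norm (L x - \<mu> *\<^sub>C x)" if "\<mu> \<in> sphere 0 1" for \<mu>
  proof -
    have "invertible_op (\<lambda>x. L x - \<mu> *\<^sub>C x)"
      using that assms by (auto simp: hyperbolic_op_def op_spectrum_def)
    then obtain S where S: "bounded_clinear S" "\<And>x. S (L x - \<mu> *\<^sub>C x) = x"
      unfolding invertible_op_iff by blast
    from S(1) have "bounded_linear S" by (simp add: bounded_clinear_def)
    then obtain K where "K > 0" and K: "\<And>x. norm (S x) \<le> norm x * K"
      using bounded_linear.pos_bounded by blast
    have "inverse K * norm x \<le> norm (L x - \<mu> *\<^sub>C x)" for x
      using K[of "L x - \<mu> *\<^sub>C x"] S(2)[of x] \<open>K > 0\<close> by (simp add: field_simps)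
    then show ?thesis using \<open>K > 0\<close> by (intro exI[of _ "inverse K"]) auto
  qed
  then obtain c where c: "\<And>\<mu>. \<mu> \<in> sphere 0 1 \<Longrightarrow> c \<mu> > 0"
    "\<And>\<mu> x. \<mu> \<in> sphere 0 1 \<Longrightarrow> c \<mu> * norm x \<le> norm (L x - \<mu> *\<^sub>C x)" by metis
  obtain F where F: "F \<subseteq> sphere 0 1" "finite F" "sphere 0 1 \<subseteq> (\<Union>\<nu>\<in>F. ball \<nu> (c \<nu> / 2))"
    by (rule compactE_image[of "sphere 0 (1::real) :: complex set" "sphere 0 1"
          "\<lambda>\<nu>. ball \<nu> (c \<nu> / 2)"]) (use c(1) in force)+
  define d where "d = Min (insert 1 ((\<lambda>\<nu>. c \<nu> / 2) ` F))"
  have "d > 0" unfolding d_def using F(1,2) c(1) by (subst Min_gr_iff) auto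
  moreover have "d * norm x \<le> norm (L x - \<mu> *\<^sub>C x)" if "cmod \<mu> = 1" for \<mu> x
  proof -
    from that F(3) obtain \<nu> where \<nu>: "\<nu> \<in> F" "cmod (\<nu> - \<mu>) < c \<nu> / 2"
      by (force simp: dist_norm)
    have "d \<le> c \<nu> / 2" unfolding d_def using F(2) \<nu>(1) by (intro Min_le) auto
    then have "d * norm x \<le> (c \<nu> - cmod (\<nu> - \<mu>)) * norm x"
      using \<nu>(2) by (intro mult_right_mono) auto
    also have "\<dots> \<le> norm (L x - \<nu> *\<^sub>C x) - norm ((\<nu> - \<mu>) *\<^sub>C x)"
      using c(2)[of \<nu> x] F(1) \<nu>(1) by (auto simp: norm_scaleC left_diff_distrib)
    also have "\<dots> \<le> norm (L x - \<nu> *\<^sub>C x + (\<nu> - \<mu>) *\<^sub>C x)"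
      by (rule norm_diff_ineq)
    finally show ?thesis by (simp add: scaleC.diff_left)
  qed
  ultimately show ?thesis by blast
qed

lemma has_integral_cis_int:
  "((\<lambda>t. cis (of_int n * t) *\<^sub>C x) has_integral (if n = 0 then (2 * pi) *\<^sub>R x else 0)) {0..2*pi}"
  for x :: "'a::complex_banach"
proof (cases "n = 0")
  case True
  then show ?thesis using has_integral_const_real[of x 0 "2*pi"] by simp
next
  case False
  define F where "F z = exp (\<i> * of_int n * z) / (\<i> * of_int n)" for z
  have "(F has_field_derivative exp (\<i> * of_int n * z)) (at z)" for z
    unfolding F_def using False by (auto intro!: derivative_eq_intros)
  then have "((\<lambda>t. F (of_real t)) has_vector_derivative cis (of_int n * t)) (at t within {0..2*pi})" for t
    by (intro has_vector_derivative_real_field) (simp add: cis_conv_exp mult.assoc)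
  from fundamental_theorem_of_calculus[of 0 "2*pi", OF _ this]
  have "((\<lambda>t. cis (of_int n * t)) has_integral F (of_real (2*pi)) - F 0) {0..2*pi}" by simp
  moreover have "F (of_real (2*pi)) = F 0"
    using exp_integer_2pi[of "of_int n"] by (simp add: F_def mult_ac)
  ultimately have "((\<lambda>t. cis (of_int n * t)) has_integral 0) {0..2*pi}" by simp
  from has_integral_linear[OF this scaleC.bounded_linear_left[of x]] show ?thesis
    using False by (simp add: o_def scaleC.zero_left)
qed

text \<open>The sequence is \<open>g\<^sub>n = (2\<pi>)\<^sup>-\<^sup>1 \<integral> e\<^bsup>int\<^esup> (L - e\<^bsup>it\<^esup>)\<^sup>-\<^sup>1 x dt\<close>. Since \<open>L (L - \<mu>)\<^sup>-\<^sup>1 x = x + \<mu> (L - \<mu>)\<^sup>-\<^sup>1 x\<close>,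
  applying \<open>L\<close> shifts the index and adds the \<open>n\<close>-th Fourier coefficient of the constant \<open>x\<close>.\<close>

lemma hyperbolic_Green_sequence:
  fixes L :: "'a::complex_banach \<Rightarrow> 'a"
  assumes L: "bounded_clinear L" and hyp: "hyperbolic_op L"
  shows "\<exists>B. \<forall>x. \<exists>g :: int \<Rightarrow> 'a. (\<forall>n. norm (g n) \<le> B * norm x) \<and>
    (\<forall>n. L (g n) = g (n + 1) + (if n = 0 then x else 0))"
proof -
  interpret L: bounded_linear L using L by (simp add: bounded_clinear_def)
  have L_scaleC: "L (c *\<^sub>C x) = c *\<^sub>C L x" for c x using L by (simp add: bounded_clinear_def)
  obtain c where "c > 0" and c: "\<And>\<mu> x. cmod \<mu> = 1 \<Longrightarrow> c * norm x \<le> norm (L x - \<mu> *\<^sub>C x)"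
    using uniformly_bounded_below_on_circle[OF hyp] by blast
  have "\<exists>y. L y - \<mu> *\<^sub>C y = x" if "cmod \<mu> = 1" for \<mu> x
  proof -
    have "invertible_op (\<lambda>x. L x - \<mu> *\<^sub>C x)"
      using that hyp by (auto simp: hyperbolic_op_def op_spectrum_def)
    then show ?thesis unfolding invertible_op_iff by blast
  qed
  then obtain R where R: "\<And>\<mu> x. cmod \<mu> = 1 \<Longrightarrow> L (R \<mu> x) - \<mu> *\<^sub>C R \<mu> x = x" by metis
  have R_le: "norm (R \<mu> x) \<le> norm x / c" if "cmod \<mu> = 1" for \<mu> x
    using c[OF that, of "R \<mu> x"] R[OF that] \<open>c > 0\<close> by (simp add: field_simps)
  \<comment> \<open>The resolvent identity makes the integrand below continuous.\<close>
  have R_Lipschitz: "norm (R \<mu> x - R \<nu> x) \<le> norm x / c / c * norm (\<mu> - \<nu>)"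
    if "cmod \<mu> = 1" "cmod \<nu> = 1" for \<mu> \<nu> x
  proof -
    have "L (R \<mu> x - R \<nu> x) - \<mu> *\<^sub>C (R \<mu> x - R \<nu> x) = (\<mu> - \<nu>) *\<^sub>C R \<nu> x"
      using R[OF that(1), of x] R[OF that(2), of x]
      by (simp add: L.diff scaleC.diff_left scaleC.diff_right algebra_simps)
    then have "c * norm (R \<mu> x - R \<nu> x) \<le> cmod (\<mu> - \<nu>) * norm (R \<nu> x)"
      using c[OF that(1), of "R \<mu> x - R \<nu> x"] by (simp add: norm_scaleC)
    also have "\<dots> \<le> cmod (\<mu> - \<nu>) * (norm x / c)"
      by (intro mult_left_mono R_le that) simp
    finally show ?thesis using \<open>c > 0\<close> by (simp add: field_simps)
  qed
  have R_cont: "continuous_on (sphere 0 1) (\<lambda>\<mu>. R \<mu> x)" for x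
    by (rule lipschitz_on_continuous_on[of "norm x / c / c"], rule lipschitz_onI)
       (use R_Lipschitz \<open>c > 0\<close> in \<open>auto simp: dist_norm\<close>)
  show ?thesis
  proof (intro exI[of _ "1 / c"] allI)
    fix x
    define f where "f n t = cis (of_int n * t) *\<^sub>C R (cis t) x" for n :: int and t :: real
    define g where "g n = (1 / (2*pi)) *\<^sub>R integral {0..2*pi} (f n)" for n
    have f_cont: "continuous_on {0..2*pi} (f n)" for n
      unfolding f_def
      by (intro scaleC.continuous_on continuous_on_compose2[OF R_cont] continuous_intros) auto
    have f_int: "f n integrable_on {0..2*pi}" for n
      by (intro integrable_continuous_interval f_cont)
    have "norm (integral {0..2*pi} (f n)) \<le> norm x / c * (2*pi - 0)" for n
      by (rule integral_bound[OF _ f_cont]) (auto simp: f_def norm_scaleC R_le)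
    then have "norm (g n) \<le> 1 / c * norm x" for n
      by (simp add: g_def field_simps)
    moreover have "L (g n) = g (n + 1) + (if n = 0 then x else 0)" for n
    proof -
      have Lf: "L (f n t) = f (n + 1) t + cis (of_int n * t) *\<^sub>C x" for t
      proof -
        have "L (R (cis t) x) = cis t *\<^sub>C R (cis t) x + x"
          using R[of "cis t" x] by (simp add: algebra_simps)
        then show ?thesis
          by (simp add: f_def L_scaleC scaleC_add_right scaleC_scaleC cis_mult algebra_simps)
      qed
      have "integral {0..2*pi} (\<lambda>t. L (f n t)) = L (integral {0..2*pi} (f n))"
        using integral_linear[OF f_int L.bounded_linear_axioms] by (simp add: o_def)
      moreover have "integral {0..2*pi} (\<lambda>t. L (f n t)) =
          integral {0..2*pi} (f (n + 1)) + (if n = 0 then (2*pi) *\<^sub>R x else 0)"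
        unfolding Lf
        by (intro integral_unique has_integral_add integrable_integral f_int has_integral_cis_int)
      ultimately have "L (integral {0..2*pi} (f n)) =
          integral {0..2*pi} (f (n + 1)) + (if n = 0 then (2*pi) *\<^sub>R x else 0)" by simp
      then show ?thesis by (simp add: g_def L.scaleR scaleR_add_right)
    qed
    ultimately show "\<exists>g :: int \<Rightarrow> 'a. (\<forall>n. norm (g n) \<le> 1 / c * norm x) \<and>
        (\<forall>n. L (g n) = g (n + 1) + (if n = 0 then x else 0))" by blast
  qed
qed

section \<open>Slowly growing orbits of a hyperbolic operator\<close>

text \<open>Put \<open>s\<^sub>n = e\<^bsup>-int\<^esup> z\<^sub>n\<close> and let \<open>T\<^sub>N(t)\<close> be the Fejer sum of all \<open>s\<^bsub>j-k\<^esub>\<close> with \<open>0 \<le> j, k < N\<close>.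
  On this sum, \<open>L - e\<^bsup>it\<^esup>\<close> acts as a difference operator, and applying it twice telescopes both
  summations. Only four boundary terms of size \<open>O(\<surd>N)\<close> remain, and since \<open>L - e\<^bsup>it\<^esup>\<close> is bounded below,
  \<open>T\<^sub>N(t)\<close> is \<open>O(\<surd>N)\<close> uniformly in \<open>t\<close>. But the mean of \<open>T\<^sub>N\<close> over the circle picks out the diagonal
  \<open>j = k\<close> and equals \<open>N z\<^sub>0\<close>. The growth rate \<open>\<surd>n\<close> could be any sublinear one; this one is matched
  to the Gaussian tolerance used for shadowing.\<close>

lemma hyperbolic_orbit_trivial:
  fixes L :: "'a::complex_banach \<Rightarrow> 'a" and z :: "int \<Rightarrow> 'a"
  assumes L: "bounded_clinear L" and hyp: "hyperbolic_op L"
    and orbit: "\<And>n. z (n + 1) = L (z n)"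
    and growth: "\<And>n. norm (z n) \<le> C * sqrt (1 + \<bar>real_of_int n\<bar>)"
  shows "z 0 = 0"
proof -
  interpret L: bounded_linear L using L by (simp add: bounded_clinear_def)
  have L_scaleC: "L (c *\<^sub>C x) = c *\<^sub>C L x" for c x using L by (simp add: bounded_clinear_def)
  obtain c where "c > 0" and c: "\<And>\<mu> x. cmod \<mu> = 1 \<Longrightarrow> c * norm x \<le> norm (L x - \<mu> *\<^sub>C x)"
    using uniformly_bounded_below_on_circle[OF hyp] by blast
  have "C \<ge> 0" using order_trans[OF norm_ge_zero growth[of 0]] by simp
  define s where "s t n = cis (of_int (- n) * t) *\<^sub>C z n" for t and n :: int
  define T where "T N t = (\<Sum>k<N. \<Sum>j<N. s t (int j - int k))" for N :: nat and t
  have T_le: "norm (T N t) \<le> 4 * C * sqrt (real N + 2) / c\<^sup>2" for N t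
  proof -
    define D where "D x = L x - cis t *\<^sub>C x" for x
    have D_s: "D (s t n) = cis t *\<^sub>C (s t (n + 1) - s t n)" for n
      by (simp add: D_def s_def L_scaleC scaleC.diff_right scaleC_scaleC cis_mult algebra_simps flip: orbit)
    have D_sum: "D (sum f A) = (\<Sum>i\<in>A. D (f i))" for f and A :: "nat set"
      by (simp add: D_def L.sum scaleC.sum_right sum_subtractf)
    have D_scaleC: "D (a *\<^sub>C x) = a *\<^sub>C D x" for a x
      by (simp add: D_def L_scaleC scaleC.diff_right scaleC_scaleC mult.commute)
    have D_diff: "D (x - y) = D x - D y" for x y
      by (simp add: D_def L.diff scaleC.diff_right)
    have D_T: "D (T N t) = cis t *\<^sub>C (\<Sum>k<N. s t (int N - int k) - s t (- int k))"
    proof -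
      have "(\<Sum>j<N. D (s t (int j - int k))) = cis t *\<^sub>C (s t (int N - int k) - s t (- int k))" for k
        using sum_lessThan_telescope[of "\<lambda>j. s t (int j - int k)" N]
        by (simp add: D_s diff_add_eq add.commute[of 1] flip: scaleC.sum_right)
      then show ?thesis by (simp add: T_def D_sum scaleC.sum_right)
    qed
    have "(\<Sum>k<N. D (s t (m - int k))) = cis t *\<^sub>C (s t (m + 1) - s t (m + 1 - int N))" for m
      using sum_lessThan_telescope'[of "\<lambda>k. s t (m + 1 - int k)" N]
      by (simp add: D_s diff_add_eq flip: scaleC.sum_right)
    from this[of "int N"] this[of 0]
    have D_D_T: "D (D (T N t)) =
        cis t *\<^sub>C cis t *\<^sub>C (s t (int N + 1) - s t 1 - (s t 1 - s t (1 - int N)))"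
      by (simp add: D_T D_scaleC D_sum D_diff sum_subtractf scaleC.diff_right)
    have s_le: "norm (s t n) \<le> C * sqrt (real N + 2)" if "\<bar>n\<bar> \<le> int N + 1" for n
    proof -
      have "norm (s t n) \<le> C * sqrt (1 + \<bar>real_of_int n\<bar>)"
        using growth by (simp add: s_def norm_scaleC)
      also have "\<dots> \<le> C * sqrt (real N + 2)"
        using that \<open>C \<ge> 0\<close> by (intro mult_left_mono real_sqrt_le_mono) linarith+
      finally show ?thesis .
    qed
    have "c * (c * norm (T N t)) \<le> c * norm (D (T N t))"
      unfolding D_def using \<open>c > 0\<close> by (intro mult_left_mono c) auto
    also have "\<dots> \<le> norm (D (D (T N t)))"
      unfolding D_def[of "D _"] by (rule c) simp
    also have "\<dots> \<le> norm (s t (int N + 1)) + norm (s t 1) + (norm (s t 1) + norm (s t (1 - int N)))"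
      unfolding D_D_T norm_scaleC norm_cis mult_1_left
      by (intro order_trans[OF norm_triangle_ineq4] add_mono) auto
    also have "\<dots> \<le> 4 * (C * sqrt (real N + 2))"
      using s_le[of "int N + 1"] s_le[of 1] s_le[of "1 - int N"] by linarith
    finally show ?thesis using \<open>c > 0\<close> by (simp add: field_simps power2_eq_square)
  qed
  have T_int: "(T N has_integral (2*pi * real N) *\<^sub>R z 0) {0..2*pi}" for N
  proof -
    have "(T N has_integral
        (\<Sum>k<N. \<Sum>j<N. if - (int j - int k) = 0 then (2*pi) *\<^sub>R z (int j - int k) else 0)) {0..2*pi}"
      unfolding T_def s_def by (intro has_integral_sum has_integral_cis_int) auto
    moreover have "(\<Sum>j<N. if - (int j - int k) = 0 then (2*pi) *\<^sub>R z (int j - int k) else 0)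
        = (2*pi) *\<^sub>R z 0" if "k < N" for k
    proof -
      have "(\<Sum>j<N. if - (int j - int k) = 0 then (2*pi) *\<^sub>R z (int j - int k) else 0)
          = (\<Sum>j<N. if k = j then (2*pi) *\<^sub>R z 0 else 0)"
        by (intro sum.cong) auto
      then show ?thesis using that by simp
    qed
    ultimately show ?thesis by (simp add: mult.commute scaleR_sum_left sum_constant_scaleR)
  qed
  have z_le: "norm (z 0) \<le> 8 * C / c\<^sup>2 / sqrt (real N)" if "N > 0" for N
  proof -
    have "norm ((2*pi * real N) *\<^sub>R z 0) \<le> 4 * C * sqrt (real N + 2) / c\<^sup>2 * measure lborel {0..2*pi}"
      by (rule has_integral_bound_real[OF _ finite.emptyI T_int]) (use T_le \<open>C \<ge> 0\<close> in auto)
    then have "2*pi * (real N * norm (z 0)) \<le> 2*pi * (4 * C / c\<^sup>2 * sqrt (real N + 2))"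
      by (simp add: mult_ac)
    then have "real N * norm (z 0) \<le> 4 * C / c\<^sup>2 * sqrt (real N + 2)"
      by (rule mult_left_le_imp_le) simp
    also have "sqrt (real N + 2) \<le> sqrt (4 * real N)"
      using that by (intro real_sqrt_le_mono) simp
    then have "4 * C / c\<^sup>2 * sqrt (real N + 2) \<le> 4 * C / c\<^sup>2 * (2 * sqrt (real N))"
      using \<open>C \<ge> 0\<close> by (intro mult_left_mono) (simp_all add: real_sqrt_mult)
    finally have "sqrt (real N) * (sqrt (real N) * norm (z 0)) \<le> sqrt (real N) * (8 * C / c\<^sup>2)"
      by (simp add: mult_ac flip: mult.assoc[of "sqrt _" "sqrt _"])
    then have "sqrt (real N) * norm (z 0) \<le> 8 * C / c\<^sup>2"
      by (rule mult_left_le_imp_le) (use that in simp)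
    then show ?thesis using that by (subst pos_le_divide_eq) (simp_all add: mult.commute)
  qed
  have "(\<lambda>N. 8 * C / c\<^sup>2 / sqrt (real N)) \<longlonglongrightarrow> 0"
    by (intro tendsto_divide_0[OF tendsto_const] filterlim_at_top_imp_at_infinity
        filterlim_compose[OF sqrt_at_top filterlim_real_sequentially])
  moreover have "eventually (\<lambda>N. norm (z 0) \<le> 8 * C / c\<^sup>2 / sqrt (real N)) sequentially"
    by (rule eventually_sequentiallyI[of 1], rule z_le) simp
  ultimately have "norm (z 0) \<le> 0" by (rule tendsto_lowerbound) simp
  then show ?thesis by simp
qed

section \<open>A saddle cannot have the topological shadowing property\<close>

lemma int_iterate_step:
  assumes "bij f"
  shows "int_iterate f (n + 1) y = f (int_iterate f n y)"
proof -
  consider "n \<ge> 0" | "n = - 1" | "n < - 1" by linarith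
  then show ?thesis
  proof cases
    case 1
    then show ?thesis by (simp add: int_iterate_def nat_add_distrib)
  next
    case 2
    then show ?thesis using assms by (simp add: int_iterate_def surj_f_inv_f bij_is_surj)
  next
    case 3
    then have "nat (- n) = Suc (nat (- (n + 1)))" by simp
    with 3 show ?thesis using assms
      by (simp add: int_iterate_def surj_f_inv_f bij_is_surj del: minus_add_distrib)
  qed
qed

text \<open>The pseudo orbit comes in along \<open>t \<alpha>\<close> and leaves along \<open>t \<beta>\<close>. The uniqueness of bounded
  orbits identifies the shadowing orbit as \<open>t (\<alpha> + \<beta>)\<close>, and the fast decay of the tolerance at
  infinity then contradicts the growth of \<open>\<alpha>\<close> in backward time.\<close>

lemma no_shadowing_if_saddle:
  fixes L :: "'a::complex_banach \<Rightarrow> 'a" and \<alpha> \<beta> :: "int \<Rightarrow> 'a"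
  assumes inv: "invertible_op L" and hyp: "hyperbolic_op L"
    and \<alpha>: "\<And>n. \<alpha> (n + 1) = L (\<alpha> n)" "\<And>n. n \<ge> 0 \<Longrightarrow> norm (\<alpha> n) \<le> A" "\<alpha> 0 \<noteq> 0"
    and \<beta>: "\<And>n. \<beta> (n + 1) = L (\<beta> n)" "\<And>n. n \<le> 0 \<Longrightarrow> norm (\<beta> n) \<le> B" "\<beta> 0 \<noteq> 0"
  shows "\<not> topological_shadowing L"
proof
  assume shadowing: "topological_shadowing L"
  obtain S where L: "bounded_clinear L" and S: "\<And>x. S (L x) = x" "\<And>x. L (S x) = x"
    using inv unfolding invertible_op_iff by blast
  interpret L: bounded_linear L using L by (simp add: bounded_clinear_def)
  have "bij L" by (rule o_bij[of S]) (simp_all add: fun_eq_iff S)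
  have "A \<ge> 0" "B \<ge> 0"
    using order_trans[OF norm_ge_zero \<alpha>(2)[of 0]] order_trans[OF norm_ge_zero \<beta>(2)[of 0]] by auto

  define \<epsilon> where "\<epsilon> x = exp (- (norm x)\<^sup>2)" for x :: 'a
  have "\<epsilon> \<in> pos_continuous"
    unfolding pos_continuous_def \<epsilon>_def by (auto intro!: continuous_intros)
  then obtain \<delta> where \<delta>: "\<delta> \<in> pos_continuous"
    and shadow: "\<And>x. pseudo_orbit L \<delta> x \<Longrightarrow> can_be_shadowed L \<epsilon> x"
    using shadowing unfolding topological_shadowing_def by blast
  have \<delta>_cont: "continuous_on UNIV \<delta>" and "\<delta> 0 > 0"
    using \<delta> by (auto simp: pos_continuous_def)

  \<comment> \<open>\<open>\<delta>\<close> is bounded away from \<open>0\<close> near the origin, while the jump is proportional to \<open>t\<close>.\<close>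
  obtain t where "t > 0" and t: "norm (t *\<^sub>R (\<alpha> 1 - \<beta> 1)) < \<delta> (t *\<^sub>R \<alpha> 1)"
  proof -
    define F where "F t = \<delta> (t *\<^sub>R \<alpha> 1) - norm (t *\<^sub>R (\<alpha> 1 - \<beta> 1))" for t
    have "continuous_on UNIV F"
      unfolding F_def by (intro continuous_intros continuous_on_compose2[OF \<delta>_cont]) auto
    then have "(F \<longlongrightarrow> F 0) (at 0)" by (simp add: continuous_on_def)
    then have "(F \<longlongrightarrow> F 0) (at_right 0)" by (rule tendsto_within_subset) simp
    then have "(F \<longlongrightarrow> \<delta> 0) (at_right 0)" by (simp add: F_def)
    from order_tendstoD(1)[OF this \<open>\<delta> 0 > 0\<close>]
    have "eventually (\<lambda>t. t > 0 \<and> norm (t *\<^sub>R (\<alpha> 1 - \<beta> 1)) < \<delta> (t *\<^sub>R \<alpha> 1)) (at_right (0::real))"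
      using eventually_at_right_less[of 0] by eventually_elim (simp add: F_def)
    from eventually_happens[OF this] show ?thesis using that by auto
  qed

  define x where "x n = t *\<^sub>R (if n \<le> 0 then \<alpha> n else \<beta> n)" for n
  have "dist (L (x n)) (x (n + 1)) < \<delta> (L (x n))" for n
  proof (cases "n = 0")
    case True
    then show ?thesis
      using t \<alpha>(1)[of 0] by (simp add: x_def L.scaleR dist_norm scaleR_diff_right)
  next
    case False
    then have "L (x n) = x (n + 1)" by (auto simp: x_def L.scaleR \<alpha>(1) \<beta>(1))
    then show ?thesis using \<delta> by (simp add: pos_continuous_def)
  qed
  then obtain y where y: "\<And>n. dist (int_iterate L n y) (x n) < \<epsilon> (int_iterate L n y)"
    using shadow[of x] unfolding pseudo_orbit_def can_be_shadowed_def by blast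
  define \<eta> where "\<eta> n = int_iterate L n y" for n
  have \<eta>: "\<eta> (n + 1) = L (\<eta> n)" for n
    unfolding \<eta>_def by (rule int_iterate_step[OF \<open>bij L\<close>])
  have near: "norm (\<eta> n - x n) < exp (- (norm (\<eta> n))\<^sup>2)" for n
    using y[of n] by (simp add: \<eta>_def \<epsilon>_def dist_norm)
  have near_1: "norm (\<eta> n - x n) < 1" for n
    by (rule less_le_trans[OF near]) simp

  \<comment> \<open>The difference is an orbit. On each half-line the shadowing error bounds it up to the one
      of \<open>t \<alpha>\<close>, \<open>t \<beta>\<close> that is absent from \<open>x\<close>, and that one is bounded there.\<close>
  have split: "\<eta> m = t *\<^sub>R \<alpha> m + t *\<^sub>R \<beta> m" for m
  proof -
    define z where "z n = \<eta> n - t *\<^sub>R \<alpha> n - t *\<^sub>R \<beta> n" for n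
    have z_le: "norm (z n) \<le> 1 + t * A + t * B" for n
    proof -
      define w where "w = t *\<^sub>R (if n \<le> 0 then \<beta> n else \<alpha> n)"
      have "z n = \<eta> n - x n - w" by (simp add: z_def x_def w_def)
      then have "norm (z n) \<le> norm (\<eta> n - x n) + norm w" by (simp add: norm_triangle_ineq4)
      moreover have "norm w \<le> t * max A B"
        unfolding w_def using \<open>t > 0\<close> \<alpha>(2)[of n] \<beta>(2)[of n] by (auto intro!: mult_left_mono)
      moreover have "t * max A B \<le> t * A + t * B"
        using \<open>t > 0\<close> \<open>A \<ge> 0\<close> \<open>B \<ge> 0\<close> by (auto simp: max_def)
      ultimately show ?thesis using near_1[of n] by linarith
    qed
    have "z (0 + m) = 0"
    proof (rule hyperbolic_orbit_trivial[OF L hyp, of "\<lambda>n. z (n + m)" "1 + t * A + t * B"])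
      show "z (n + 1 + m) = L (z (n + m))" for n
        using \<eta>[of "n + m"] \<alpha>(1)[of "n + m"] \<beta>(1)[of "n + m"]
        by (simp add: z_def L.diff L.scaleR add.commute add.left_commute)
      show "norm (z (n + m)) \<le> (1 + t * A + t * B) * sqrt (1 + \<bar>real_of_int n\<bar>)" for n
        using z_le[of "n + m"] mult_left_mono[of 1 "sqrt (1 + \<bar>real_of_int n\<bar>)" "1 + t * A + t * B"]
          \<open>t > 0\<close> \<open>A \<ge> 0\<close> \<open>B \<ge> 0\<close> by simp
    qed
    then show ?thesis by (simp add: z_def algebra_simps)
  qed

  obtain K where K: "K \<ge> 1" "\<And>x. norm (L x) \<le> K * norm x"
  proof -
    obtain K where K: "norm (L x) \<le> norm x * K" for x using L.bounded by blast
    have "norm (L x) \<le> max 1 K * norm x" for x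
      using K[of x] mult_left_mono[of K "max 1 K" "norm x"] by (simp add: mult.commute)
    then show ?thesis by (intro that[of "max 1 K"]) auto
  qed
  have \<beta>_ge: "norm (\<beta> 0) \<le> K ^ k * norm (\<beta> (- int k))" for k
  proof (induction k)
    case (Suc k)
    have "norm (\<beta> (- int k)) \<le> K * norm (\<beta> (- int (Suc k)))"
      using K(2)[of "\<beta> (- int (Suc k))"] \<beta>(1)[of "- int (Suc k)"] by simp
    then have "K ^ k * norm (\<beta> (- int k)) \<le> K ^ k * (K * norm (\<beta> (- int (Suc k))))"
      using K(1) by (intro mult_left_mono) auto
    with Suc show ?case by (simp add: mult_ac)
  qed simp

  \<comment> \<open>Taking logarithms in
      \<open>t \<parallel>\<beta>\<^sub>0\<parallel> \<le> K\<^sup>k \<parallel>t \<beta>\<^bsub>-k\<^esub>\<parallel> < K\<^sup>k exp (- \<parallel>\<eta>\<^bsub>-k\<^esub>\<parallel>\<^sup>2)\<close> bounds \<open>\<parallel>\<eta>\<^bsub>-k\<^esub>\<parallel>\<^sup>2\<close> linearly in \<open>k\<close>.\<close>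
  define D where "D = ln K + \<bar>ln (t * norm (\<beta> 0))\<bar>"
  have "D \<ge> 0" using K(1) by (simp add: D_def)
  have \<eta>_le: "norm (\<eta> (- int k)) \<le> sqrt D * sqrt (1 + real k)" for k
  proof -
    have "t * norm (\<beta> 0) \<le> K ^ k * (t * norm (\<beta> (- int k)))"
      using \<beta>_ge[of k] \<open>t > 0\<close> by (simp add: mult_ac)
    also have "\<dots> \<le> K ^ k * exp (- (norm (\<eta> (- int k)))\<^sup>2)"
      using near[of "- int k"] K(1) \<open>t > 0\<close> split[of "- int k"]
      by (intro mult_left_mono) (auto simp: x_def)
    finally have "ln (t * norm (\<beta> 0)) \<le> ln (K ^ k * exp (- (norm (\<eta> (- int k)))\<^sup>2))"
      using \<open>t > 0\<close> \<beta>(3) K(1) by (subst ln_le_cancel_iff) auto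
    also have "\<dots> = real k * ln K - (norm (\<eta> (- int k)))\<^sup>2"
      using K(1) by (simp add: ln_mult ln_realpow)
    finally have "(norm (\<eta> (- int k)))\<^sup>2 \<le> real k * ln K + \<bar>ln (t * norm (\<beta> 0))\<bar>"
      by linarith
    also have "\<dots> \<le> D * (1 + real k)"
      using K(1) by (simp add: D_def algebra_simps)
    finally show ?thesis by (simp add: real_le_rsqrt flip: real_sqrt_mult)
  qed
  have "t *\<^sub>R \<alpha> 0 = 0"
  proof (rule hyperbolic_orbit_trivial[OF L hyp, of "\<lambda>n. t *\<^sub>R \<alpha> n" "sqrt D + t * B + t * A"])
    show "t *\<^sub>R \<alpha> (n + 1) = L (t *\<^sub>R \<alpha> n)" for n by (simp add: \<alpha>(1) L.scaleR)
    fix n :: int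
    define r where "r = sqrt (1 + \<bar>real_of_int n\<bar>)"
    have "r \<ge> 1" by (simp add: r_def)
    have "0 \<le> sqrt D" "0 \<le> t * A" "0 \<le> t * B" using \<open>t > 0\<close> \<open>A \<ge> 0\<close> \<open>B \<ge> 0\<close> \<open>D \<ge> 0\<close> by auto
    then have absorb: "sqrt D * r + t * B + t * A \<le> (sqrt D + t * B + t * A) * r"
      using \<open>r \<ge> 1\<close> by (simp add: distrib_right mult_le_cancel_left1 add_mono)
    have "norm (t *\<^sub>R \<alpha> n) \<le> sqrt D * r + t * B + t * A"
    proof (cases "n \<ge> 0")
      case True
      then have "norm (t *\<^sub>R \<alpha> n) \<le> t * A" using \<alpha>(2) \<open>t > 0\<close> by simp
      then show ?thesis using \<open>0 \<le> sqrt D\<close> \<open>0 \<le> t * B\<close> \<open>r \<ge> 1\<close> by (simp add: add_increasing)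
    next
      case False
      have "t *\<^sub>R \<alpha> n = \<eta> n - t *\<^sub>R \<beta> n" by (simp add: split)
      then have "norm (t *\<^sub>R \<alpha> n) \<le> norm (\<eta> n) + norm (t *\<^sub>R \<beta> n)"
        by (metis norm_triangle_ineq4)
      moreover have "norm (\<eta> n) \<le> sqrt D * r"
        using \<eta>_le[of "nat (- n)"] False by (simp add: r_def)
      moreover have "norm (t *\<^sub>R \<beta> n) \<le> t * B" using \<beta>(2)[of n] False \<open>t > 0\<close> by simp
      ultimately show ?thesis using \<open>0 \<le> t * A\<close> by linarith
    qed
    with absorb show "norm (t *\<^sub>R \<alpha> n) \<le> (sqrt D + t * B + t * A) * sqrt (1 + \<bar>real_of_int n\<bar>)"
      by (simp add: r_def)
  qed
  with \<open>t > 0\<close> \<alpha>(3) show False by simp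
qed

section \<open>The spectrum lies on one side of the circle\<close>

theorem lemma7:
  fixes L :: "'a::complex_banach \<Rightarrow> 'a"
  assumes "(UNIV :: 'a set) \<noteq> {0}"
    and "invertible_op L"
    and "hyperbolic_op L"
    and "topological_shadowing L"
  shows "op_spectrum L \<subseteq> ball 0 1 \<or> op_spectrum L \<subseteq> UNIV - cball 0 1"
proof (rule ccontr)
  assume contra: "\<not> ?thesis"
  have off_circle: "\<mu> \<notin> op_spectrum L" if "cmod \<mu> = 1" for \<mu>
    using assms(3) that by (auto simp: hyperbolic_op_def)
  obtain S where L: "bounded_clinear L" and S: "bounded_clinear S"
    and SL: "\<And>x. S (L x) = x" and LS: "\<And>x. L (S x) = x"
    using assms(2) unfolding invertible_op_iff by blast
  have "bij L" by (rule o_bij[of S]) (simp_all add: fun_eq_iff SL LS)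
  obtain B where "\<forall>x. \<exists>g :: int \<Rightarrow> 'a. (\<forall>n. norm (g n) \<le> B * norm x) \<and>
    (\<forall>n. L (g n) = g (n + 1) + (if n = 0 then x else 0))"
    using hyperbolic_Green_sequence[OF L assms(3)] by blast
  then obtain g :: "'a \<Rightarrow> int \<Rightarrow> 'a" where g_le: "\<And>x n. norm (g x n) \<le> B * norm x"
    and g: "\<And>x n. L (g x n) = g x (n + 1) + (if n = 0 then x else 0)" by metis

  have forward: "(L ^^ k) (g x 1) = g x (1 + int k)" for x k
    by (induction k) (simp_all add: g add.commute)
  have backward: "(S ^^ k) (g x 0) = g x (- int k)" for x k
  proof (induction k)
    case (Suc k)
    have "L (g x (- int (Suc k))) = g x (- int k)" using g[of x "- int (Suc k)"] by simp
    then show ?case using Suc SL by (metis funpow.simps(2) comp_apply)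
  qed simp

  \<comment> \<open>Without such a \<open>p\<close>, always \<open>g x 0 = L\<^sup>-\<^sup>1 x\<close>, so the bound on \<open>g\<close> makes \<open>L\<^sup>-\<^sup>1\<close> power bounded.\<close>
  obtain p where p: "g p 1 \<noteq> 0"
  proof (rule ccontr)
    assume "\<not> thesis"
    then have "g x 1 = 0" for x using that by blast
    then have "g x 0 = S x" for x using g[of x 0] SL by (metis add_0 add.right_neutral)
    then have "norm ((S ^^ k) (S x)) \<le> B * norm x" for k x
      using backward[of k x] g_le[of x "- int k"] by simp
    then have S_le: "norm ((S ^^ Suc k) x) \<le> B * norm x" for k x
      by (simp add: funpow_swap1)
    have "norm ((S ^^ k) x) \<le> max 1 B * norm x" for k x
    proof (cases k)
      case 0
      then show ?thesis using mult_right_mono[of 1 "max 1 B" "norm x"] by simp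
    next
      case (Suc m)
      have "norm ((S ^^ k) x) \<le> B * norm x" unfolding Suc by (rule S_le)
      also have "\<dots> \<le> max 1 B * norm x" by (intro mult_right_mono) auto
      finally show ?thesis .
    qed
    from op_spectrum_subset_if_inverse_power_bounded[OF L S SL LS this]
    show False using contra off_circle by force
  qed
  \<comment> \<open>Without such a \<open>q\<close>, always \<open>g x 1 = - x\<close>, so the bound on \<open>g\<close> makes \<open>L\<close> power bounded.\<close>
  obtain q where q: "g q 0 \<noteq> 0"
  proof (rule ccontr)
    assume "\<not> thesis"
    then have "g x 0 = 0" for x using that by blast
    then have "g x 1 = - x" for x
      using g[of x 0] L by (simp add: bounded_clinear_def linear_0 bounded_linear.linear eq_neg_iff_add_eq_0)
    moreover have "(L ^^ k) (- x) = - (L ^^ k) x" for k x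
      using L by (induction k) (simp_all add: bounded_clinear_def bounded_linear.linear linear_neg)
    ultimately have "norm ((L ^^ k) x) \<le> B * norm x" for k x
      using forward[of k x] g_le[of x "1 + int k"] by (metis norm_minus_cancel)
    from op_spectrum_subset_if_power_bounded[OF L this]
    show False using contra off_circle by force
  qed

  have "inv L = S" using SL LS by (intro inv_equality)
  have "\<not> topological_shadowing L"
  proof (rule no_shadowing_if_saddle[OF assms(2,3),
        where \<alpha> = "\<lambda>n. int_iterate L n (g p 1)" and \<beta> = "\<lambda>n. int_iterate L n (g q 0)"])
    show "norm (int_iterate L n (g p 1)) \<le> B * norm p" if "n \<ge> 0" for n
      using that g_le by (simp add: int_iterate_def forward)
    show "norm (int_iterate L n (g q 0)) \<le> B * norm q" if "n \<le> 0" for n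
    proof -
      have "int_iterate L n (g q 0) = g q n"
        using that backward[of "nat (- n)" q] by (cases "n = 0") (auto simp: int_iterate_def \<open>inv L = S\<close>)
      then show ?thesis using g_le by simp
    qed
  qed (simp_all add: int_iterate_step[OF \<open>bij L\<close>], simp_all add: int_iterate_def p q)
  with assms(4) show False by contradiction
qed

end
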